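(* Let $G$ be a finite group, $H$ a subgroup, and $S\subset G$ with $S_H=S\cap H$ symmetric; let $S_O=S\setminus H$. The number of connected components of $\mathcal{G}(G,H,S)$ equals \[[H:\langle H\cap (S_H\cup S_OS_O^{-1})\rangle] + |G\setminus H| - \Big|\bigcup_{s\in S_O} Hs\Big|.\]
   Context: A subset $X\subset G$ is symmetric if $X^{-1}=X$. The group-subgroup pair graph $\mathcal{G}(G,H,S)$ is the undirected graph with vertex set $G$ whose edges are exactly the pairs $\{h,hs\}$ with $h\in H$, $s\in S$. Here $S_OS_O^{-1}=\{st^{-1}: s,t\in S_O\}$ and $\langle X\rangle$ is the subgroup generated by $X$. *)

theory Defs
  imports
    "HOL-Algebra.Coset"
    "HOL-Algebra.Generated_Groups"
    "Graph_Theory.Graph_Theory"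
begin

text \<open>
  As in the graph library, an undirected graph is modelled as a symmetric digraph: the edge
  $\{h, hs\}$ is the pair of arcs $(h, hs)$, $(hs, h)$. If $1 \in S$, this gives a loop at every
  $h \in H$; loops do not affect connectedness.
\<close>

definition group_subgroup_pair_graph ::
    "('a, 'b) monoid_scheme \<Rightarrow> 'a set \<Rightarrow> 'a set \<Rightarrow> 'a pair_pre_digraph" where
  "group_subgroup_pair_graph G H S =
    \<lparr> pverts = carrier G,
      parcs = (\<Union>h\<in>H. \<Union>s\<in>S. {(h, h \<otimes>\<^bsub>G\<^esub> s), (h \<otimes>\<^bsub>G\<^esub> s, h)}) \<rparr>"

text \<open>
  Maximal connected subgraphs. \<^const>\<open>Digraph_Component.connected\<close> refers to the underlying
  undirected graph and excludes the empty graph.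
\<close>

definition connected_components :: "('a, 'b) pre_digraph \<Rightarrow> ('a, 'b) pre_digraph set" where
  "connected_components \<Gamma> = {C. pre_digraph.max_subgraph \<Gamma> Digraph_Component.connected C}"

definition subgroup_index :: "('a, 'b) monoid_scheme \<Rightarrow> 'a set \<Rightarrow> 'a set \<Rightarrow> nat" where
  "subgroup_index G H K = card (rcosets\<^bsub>G\<lparr>carrier := H\<rparr>\<^esub> K)"

end

theory Submission
  imports Defs
begin

text \<open>
  Put $K = \langle H \cap (S_H \cup S_O S_O^{-1})\rangle$. The component of $h \in H$ is
  $hK \cup hKS_O$: from $hk$ one moves inside $H$ by an element of $S_H$, or one steps out to $hks$
  with $s \in S_O$ and can only return to a vertex $hkst^{-1} \in H$ with $t \in S_O$. Hence the
  components meeting $H$ correspond to the left cosets of $K$ in $H$. They cover $H$ and all cosets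
  $Hs$ with $s \in S_O$; every other vertex is isolated.
\<close>

text \<open>Both images label the classes of one equivalence relation on \<open>A\<close>. This
  later trades components for cosets.\<close>

lemma card_image_eq_if_same_fibres:
  assumes "\<And>x y. x \<in> A \<Longrightarrow> y \<in> A \<Longrightarrow> f x = f y \<longleftrightarrow> g x = g y"
  shows "card (f ` A) = card (g ` A)"
proof -
  \<comment> \<open>The representative chosen by \<open>inv_into\<close> may differ from
    \<open>x\<close>, but lies in the same fibre.\<close>
  have "g (inv_into A f (f x)) = g x" if "x \<in> A" for x
    using that assms by (metis f_inv_into_f imageI inv_into_into)
  then have "bij_betw (\<lambda>c. g (inv_into A f c)) (f ` A) (g ` A)"
    using assms by (auto simp: bij_betw_def inj_on_def image_image)
  then show ?thesis
    by (rule bij_betw_same_card)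
qed

section \<open>Weak and strong components of symmetric digraphs\<close>

text \<open>Extra arcs on the same vertices cannot destroy connectedness; hence maximal connected
  subgraphs are induced.\<close>

lemma arc_mono_connected: "arc_mono Digraph_Component.connected"
  unfolding arc_mono_def
  by (metis spanning_def subgraphE wf_digraph.connected_spanning_imp_connected)

lemma strongly_connected_imp_connected:
  assumes "strongly_connected \<Gamma>"
  shows "Digraph_Component.connected \<Gamma>"
proof -
  have "arcs_ends \<Gamma> \<subseteq> (arcs_ends \<Gamma>)\<^sup>s"
    by (auto simp: symcl_def)
  then show ?thesis
    using assms unfolding connected_conv strongly_connected_def reachable_def
    by (blast intro: rtrancl_on_mono)
qed

text \<open>An induced subgraph keeps the reverse of each of its arcs, so every undirected walk can
  be directed.\<close>

lemma (in sym_digraph) induced_connected_iff_strongly_connected: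
  assumes "induced_subgraph C G"
  shows "Digraph_Component.connected C \<longleftrightarrow> strongly_connected C"
  using wf_digraph.symmetric_connected_imp_strongly_connected
    [OF wf_digraphI_induced[OF assms] induced_graph_imp_symmetric[OF sym_arcs assms]]
    strongly_connected_imp_connected by blast

text \<open>This makes components accessible through directed reachability.\<close>

lemma (in sym_digraph) connected_components_eq_sccs: "connected_components G = sccs"
proof (intro equalityI subsetI)
  fix C assume "C \<in> connected_components G"
  then have C: "max_subgraph Digraph_Component.connected C"
    by (simp add: connected_components_def)
  then have "strongly_connected C"
    using induced_connected_iff_strongly_connected[OF induced_subgraphI_arc_mono[OF C arc_mono_connected]]
      max_subgraph_prop by blast
  then show "C \<in> sccs"
    using max_subgraph_mp[OF C strongly_connected_imp_connected] by (simp add: sccs_altdef2)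
next
  fix C assume C: "C \<in> sccs"
  then have mx: "max_subgraph strongly_connected C"
    by (simp add: sccs_altdef2)
  have "max_subgraph Digraph_Component.connected C"
  proof (rule max_subgraphI)
    show "Digraph_Component.connected C"
      using mx by (blast dest: max_subgraph_prop strongly_connected_imp_connected)
    show "subgraph C G"
      using mx by (rule subgraphI_max_subgraph)
  next
    fix D assume ne: "C \<noteq> D" and CD: "subgraph C D" and DG: "subgraph D G"
    \<comment> \<open>\<open>D\<close> itself may lack reverse arcs, so it is enlarged to the
      induced subgraph on its vertices, which is symmetric.\<close>
    let ?E = "G \<restriction> verts D"
    have DE: "subgraph D ?E"
      using DG by (rule subgraph_induce_subgraphI2)
    have EG: "induced_subgraph ?E G"
      using DG by (intro induced_induce) auto
    show "\<not> Digraph_Component.connected D"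
    proof
      assume "Digraph_Component.connected D"
      then have "Digraph_Component.connected ?E"
        using arc_mono_connected DE unfolding arc_mono_def by (metis induce_subgraph_verts)
      then have "strongly_connected ?E"
        using induced_connected_iff_strongly_connected[OF EG] by simp
      then have "C = ?E"
        using mx subgraph_trans[OF CD DE] induced_imp_subgraph[OF EG]
        unfolding max_subgraph_def by metis
      \<comment> \<open>\<open>D\<close> is squeezed between \<open>C\<close> and \<open>?E\<close>,
        which coincide.\<close>
      then have "verts C = verts D" "arcs C = arcs D" "tail C = tail D" "head C = head D"
        using CD DE unfolding subgraph_def compatible_def by blast+
      then have "C = D"
        by (intro pre_digraph.equality) simp_all
      with ne show False ..
    qed
  qed
  then show "C \<in> connected_components G"
    by (simp add: connected_components_def)
qed

section \<open>The pair graph and the subgroup \<open>K\<close>\<close>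

locale group_subgroup_pair = group G for G (structure) +
  fixes H S
  assumes H_subgroup: "subgroup H G"
    and S_carrier: "S \<subseteq> carrier G"
begin

abbreviation "\<Gamma> \<equiv> group_subgroup_pair_graph G H S"

definition "S\<^sub>O = S - H"

definition "K = generate G (H \<inter> ((S \<inter> H) \<union> (S\<^sub>O <#> set_inv S\<^sub>O)))"

text \<open>The vertices outside \<open>H\<close> that have a neighbour.\<close>

definition "U = (\<Union>s\<in>S\<^sub>O. H #> s)"

lemma H_carrier: "h \<in> H \<Longrightarrow> h \<in> carrier G"
  using H_subgroup by (rule subgroup.mem_carrier)

lemma S\<^sub>O_carrier: "s \<in> S\<^sub>O \<Longrightarrow> s \<in> carrier G"
  using S_carrier by (auto simp: S\<^sub>O_def)

lemmas H_mult = subgroup.m_closed[OF H_subgroup]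
lemmas H_inv = subgroup.m_inv_closed[OF H_subgroup]

text \<open>For an arc from \<open>h\<close> to \<open>h \<otimes> s\<close>, this tells from
  \<open>s\<close> alone whether the far end stays in \<open>H\<close>.\<close>

lemma mult_in_H_iff:
  assumes "h \<in> H" "x \<in> carrier G"
  shows "h \<otimes> x \<in> H \<longleftrightarrow> x \<in> H"
  using assms H_mult H_inv H_carrier by (metis inv_closed l_inv l_one m_assoc)

lemma K_H: "K \<subseteq> H"
  unfolding K_def using H_subgroup by (intro generate_subgroup_incl) auto

lemma K_subgroup: "subgroup K G"
  unfolding K_def using H_carrier by (intro generate_is_subgroup) auto

lemmas K_mult = subgroup.m_closed[OF K_subgroup]
lemmas K_inv = subgroup.m_inv_closed[OF K_subgroup]

lemma S_in_K: "s \<in> S \<Longrightarrow> s \<in> H \<Longrightarrow> s \<in> K"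
  unfolding K_def by (rule generate.incl) auto

lemma S\<^sub>O_quotient_in_K:
  assumes "s \<in> S\<^sub>O" "t \<in> S\<^sub>O" "s \<otimes> inv t \<in> H"
  shows "s \<otimes> inv t \<in> K"
  unfolding K_def using assms by (intro generate.incl) (auto simp: set_mult_def SET_INV_def)

lemma U_subset: "U \<subseteq> carrier G - H"
  using mult_in_H_iff H_carrier S\<^sub>O_carrier by (auto simp: U_def r_coset_def) (auto simp: S\<^sub>O_def)

lemma arc_iff:
  "(x, y) \<in> parcs \<Gamma> \<longleftrightarrow> (\<exists>s\<in>S. x \<in> H \<and> y = x \<otimes> s \<or> y \<in> H \<and> x = y \<otimes> s)"
  by (auto simp: group_subgroup_pair_graph_def)

lemma pverts_\<Gamma> [simp]: "pverts \<Gamma> = carrier G"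
  by (simp add: group_subgroup_pair_graph_def)

sublocale sym_digraph "with_proj \<Gamma>"
proof
  show "tail (with_proj \<Gamma>) e \<in> verts (with_proj \<Gamma>)" "head (with_proj \<Gamma>) e \<in> verts (with_proj \<Gamma>)"
    if "e \<in> arcs (with_proj \<Gamma>)" for e
    using that S_carrier H_carrier
    by (auto simp: group_subgroup_pair_graph_def subset_iff)
  show "symmetric (with_proj \<Gamma>)"
    unfolding symmetric_def by (auto intro!: symI simp: arc_iff)
qed

section \<open>Walks that start in \<open>H\<close>\<close>

text \<open>The set of vertices of the stated form contains \<open>h\<close> and is closed under
  taking neighbours.\<close>

lemma reachable_from_H:
  assumes "h \<in> H" "h \<rightarrow>\<^sup>*\<^bsub>with_proj \<Gamma>\<^esub> v"
  shows "\<exists>k\<in>K. v = h \<otimes> k \<or> (\<exists>s\<in>S\<^sub>O. v = h \<otimes> k \<otimes> s)"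
  using assms(2)
proof (induction rule: reachable_induct)
  case base
  then show ?case
    using subgroup.one_closed[OF K_subgroup] by (auto intro!: bexI[of _ \<one>])
next
  case (step x y)
  then obtain k where k: "k \<in> K" and x: "x = h \<otimes> k \<or> (\<exists>s\<in>S\<^sub>O. x = h \<otimes> k \<otimes> s)"
    by blast
  have hk: "h \<otimes> k \<in> H" "h \<in> carrier G" "k \<in> carrier G"
    using k K_H assms(1) H_mult H_carrier by auto
  from step(2) obtain s where s: "s \<in> S" and "x \<in> H \<and> y = x \<otimes> s \<or> y \<in> H \<and> x = y \<otimes> s"
    by (auto simp: arc_iff)
  then consider (outward) "x \<in> H" "y = x \<otimes> s" | (inward) "y \<in> H" "x = y \<otimes> s"
    by blast
  then show ?case
  proof cases
    case outward
    \<comment> \<open>The other form of \<open>x\<close> lies outside \<open>H\<close>, since its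
      last factor does.\<close>
    have "x = h \<otimes> k"
      using x outward(1) mult_in_H_iff[OF hk(1)] S\<^sub>O_carrier by (auto simp: S\<^sub>O_def)
    show ?thesis
    proof (cases "s \<in> H")
      case True
      then have "y = h \<otimes> (k \<otimes> s)" "k \<otimes> s \<in> K"
        using \<open>x = h \<otimes> k\<close> outward(2) hk H_carrier S_in_K s k K_mult by (auto simp: m_assoc)
      then show ?thesis by blast
    next
      case False
      then show ?thesis
        using \<open>x = h \<otimes> k\<close> outward(2) s k by (auto simp: S\<^sub>O_def)
    qed
  next
    case inward
    have y: "y \<in> carrier G" and sc: "s \<in> carrier G"
      using inward(1) H_carrier s S_carrier by auto
    then have yx: "y = x \<otimes> inv s"
      using inward(2) by (simp add: m_assoc)
    from x show ?thesis
    proof (elim disjE bexE)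
      assume xk: "x = h \<otimes> k"
      \<comment> \<open>Both ends of the arc lie in \<open>H\<close>, so the step multiplies by the
        inverse of an element of \<open>K\<close>.\<close>
      then have "s \<in> H"
        using hk(1) inward sc mult_in_H_iff by metis
      then have "y = h \<otimes> (k \<otimes> inv s)" "k \<otimes> inv s \<in> K"
        using yx xk hk sc S_in_K s k K_mult K_inv by (auto simp: m_assoc)
      then show ?thesis by blast
    next
      fix t assume t: "t \<in> S\<^sub>O" and xk: "x = h \<otimes> k \<otimes> t"
      have tc: "t \<in> carrier G"
        using t by (rule S\<^sub>O_carrier)
      have "x \<notin> H"
        using xk t mult_in_H_iff[OF hk(1) tc] by (simp add: S\<^sub>O_def)
      then have s': "s \<in> S\<^sub>O"
        using inward sc s mult_in_H_iff by (auto simp: S\<^sub>O_def)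
      \<comment> \<open>Leaving \<open>H\<close> along \<open>t\<close> and returning along
        \<open>s\<close> multiplies by a quotient of two elements of \<open>S\<^sub>O\<close>. It
        lies in \<open>H\<close> because \<open>h \<otimes> k\<close> and \<open>y\<close> do, so it
        is a generator of \<open>K\<close>.\<close>
      have y1: "y = h \<otimes> k \<otimes> (t \<otimes> inv s)"
        using yx xk hk sc tc by (simp add: m_assoc)
      then have "t \<otimes> inv s \<in> H"
        using inward(1) mult_in_H_iff[OF hk(1)] sc tc by simp
      then have "t \<otimes> inv s \<in> K"
        using S\<^sub>O_quotient_in_K t s' by blast
      then have "y = h \<otimes> (k \<otimes> (t \<otimes> inv s))" "k \<otimes> (t \<otimes> inv s) \<in> K"
        using y1 hk sc tc k K_mult by (auto simp: m_assoc)
      then show ?thesis by blast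
    qed
  qed
qed

lemma reachable_sym: "x \<rightarrow>\<^sup>*\<^bsub>with_proj \<Gamma>\<^esub> y \<Longrightarrow> y \<rightarrow>\<^sup>*\<^bsub>with_proj \<Gamma>\<^esub> x"
  using sym_arcs by (rule symmetric_reachable)

text \<open>An element of \<open>S\<close> is a single arc; a quotient is a detour of two arcs
  through a vertex outside \<open>H\<close>.\<close>

lemma reachable_generator:
  assumes "k \<in> H \<inter> ((S \<inter> H) \<union> (S\<^sub>O <#> set_inv S\<^sub>O))" "h \<in> H"
  shows "h \<rightarrow>\<^sup>*\<^bsub>with_proj \<Gamma>\<^esub> (h \<otimes> k)"
  using assms(1)
proof (elim IntE UnE)
  assume "k \<in> S"
  then show ?thesis
    using assms(2) by (intro reachable_adjI) (auto simp: arc_iff)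
next
  assume "k \<in> H" "k \<in> S\<^sub>O <#> set_inv S\<^sub>O"
  then obtain s t where st: "s \<in> S\<^sub>O" "t \<in> S\<^sub>O" and k: "k = s \<otimes> inv t"
    by (auto simp: set_mult_def SET_INV_def)
  have c: "h \<in> carrier G" "s \<in> carrier G" "t \<in> carrier G"
    using assms(2) st H_carrier S\<^sub>O_carrier by auto
  have "h \<rightarrow>\<^bsub>with_proj \<Gamma>\<^esub> (h \<otimes> s)"
    using assms(2) st(1) by (auto simp: arc_iff S\<^sub>O_def)
  \<comment> \<open>The middle vertex of the detour is a neighbour of \<open>h \<otimes> k\<close>
    as well, along \<open>t\<close>.\<close>
  moreover have "h \<otimes> s = h \<otimes> k \<otimes> t"
    using c by (simp add: k m_assoc)
  then have "(h \<otimes> s) \<rightarrow>\<^bsub>with_proj \<Gamma>\<^esub> (h \<otimes> k)"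
    using H_mult[OF assms(2) \<open>k \<in> H\<close>] st(2) by (auto simp: arc_iff S\<^sub>O_def)
  ultimately show ?thesis
    by (blast intro: adj_reachable_trans)
qed

text \<open>Walks for the generators are concatenated. The start \<open>h\<close> is kept arbitrary
  because the walk for the second factor of a product begins at
  \<open>h \<otimes> k\<close>.\<close>

lemma reachable_mult_K:
  assumes "k \<in> K" "h \<in> H"
  shows "h \<rightarrow>\<^sup>*\<^bsub>with_proj \<Gamma>\<^esub> (h \<otimes> k)"
  using assms unfolding K_def
proof (induction arbitrary: h rule: generate.induct)
  case one
  then show ?case
    using H_carrier by simp
next
  case (incl k)
  then show ?case
    by (rule reachable_generator)
next
  case (inv k)
  then have k: "k \<in> H"
    by blast
  \<comment> \<open>The walk for the generator \<open>k\<close> is started here so that it ends at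
    \<open>h\<close>, and is then reversed.\<close>
  have "h \<otimes> inv k \<in> H"
    using inv(2) k H_mult H_inv by blast
  moreover have "h \<otimes> inv k \<otimes> k = h"
    using inv(2) k H_carrier by (simp add: m_assoc)
  ultimately have "(h \<otimes> inv k) \<rightarrow>\<^sup>*\<^bsub>with_proj \<Gamma>\<^esub> h"
    using reachable_generator[OF inv(1), of "h \<otimes> inv k"] by simp
  then show ?case
    by (rule reachable_sym)
next
  case (eng k l)
  then have kl: "k \<in> H" "l \<in> H"
    using K_H unfolding K_def by auto
  have "h \<rightarrow>\<^sup>*\<^bsub>with_proj \<Gamma>\<^esub> (h \<otimes> k)"
    using eng.IH(1) eng.prems .
  also have "(h \<otimes> k) \<rightarrow>\<^sup>*\<^bsub>with_proj \<Gamma>\<^esub> (h \<otimes> k \<otimes> l)"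
    using eng.IH(2) H_mult[OF eng.prems kl(1)] .
  also have "h \<otimes> k \<otimes> l = h \<otimes> (k \<otimes> l)"
    using eng.prems kl H_carrier by (simp add: m_assoc)
  finally show ?case .
qed

section \<open>Components meeting \<open>H\<close> as cosets of \<open>K\<close>\<close>

lemma scc_of_eq_iff:
  assumes "x \<in> carrier G" "y \<in> carrier G"
  shows "scc_of x = scc_of y \<longleftrightarrow> x \<rightarrow>\<^sup>*\<^bsub>with_proj \<Gamma>\<^esub> y"
proof
  assume "scc_of x = scc_of y"
  then have "y \<in> scc_of x"
    using in_scc_of_self assms by auto
  then show "x \<rightarrow>\<^sup>*\<^bsub>with_proj \<Gamma>\<^esub> y"
    by (simp add: scc_of_def)
next
  assume "x \<rightarrow>\<^sup>*\<^bsub>with_proj \<Gamma>\<^esub> y"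
  then show "scc_of x = scc_of y"
    by (rule scc_of_eq[OF scc_ofI_reachable])
qed

text \<open>Of the vertices reachable from \<open>h\<close>, those of the form
  \<open>h \<otimes> k \<otimes> s\<close> with \<open>s\<close> in \<open>S\<^sub>O\<close> miss
  \<open>H\<close>, which leaves exactly the left coset of \<open>K\<close> through
  \<open>h\<close>.\<close>

lemma reachable_in_H_iff:
  assumes "h \<in> H" "h' \<in> H"
  shows "h \<rightarrow>\<^sup>*\<^bsub>with_proj \<Gamma>\<^esub> h' \<longleftrightarrow> inv h \<otimes> h' \<in> K"
proof
  assume reach: "h \<rightarrow>\<^sup>*\<^bsub>with_proj \<Gamma>\<^esub> h'"
  from reachable_from_H[OF assms(1) reach]
  obtain k where k: "k \<in> K" "h' = h \<otimes> k \<or> (\<exists>s\<in>S\<^sub>O. h' = h \<otimes> k \<otimes> s)" ..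
  have c: "h \<in> carrier G" "k \<in> carrier G" "h \<otimes> k \<in> H"
    using assms(1) k(1) K_H H_carrier H_mult by auto
  have "h \<otimes> k \<otimes> s \<notin> H" if "s \<in> S\<^sub>O" for s
    using that mult_in_H_iff[OF c(3) S\<^sub>O_carrier[OF that]] by (simp add: S\<^sub>O_def)
  then have "h' = h \<otimes> k"
    using assms(2) k(2) by blast
  moreover have "inv h \<otimes> (h \<otimes> k) = k"
    using c by (subst inv_solve_left') auto
  ultimately show "inv h \<otimes> h' \<in> K"
    using k(1) by simp
next
  assume "inv h \<otimes> h' \<in> K"
  moreover have "h \<otimes> (inv h \<otimes> h') = h'"
    using inv_solve_left[of "inv h \<otimes> h'" h h'] assms[THEN H_carrier] by simp
  ultimately show "h \<rightarrow>\<^sup>*\<^bsub>with_proj \<Gamma>\<^esub> h'"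
    using reachable_mult_K[OF _ assms(1), of "inv h \<otimes> h'"] by simp
qed

text \<open>
  Components are left cosets $hK$, but the index counts right cosets; inversion sends $hK$ to
  $Kh^{-1}$.
\<close>

lemma card_scc_of_H: "card (scc_of ` H) = subgroup_index G H K"
proof -
  have "scc_of h = scc_of h' \<longleftrightarrow> K #> inv h = K #> inv h'" if "h \<in> H" "h' \<in> H" for h h'
  proof -
    have c: "inv h \<in> carrier G" "inv h' \<in> carrier G"
      using that H_carrier by auto
    have "K #> inv h = K #> inv h' \<longleftrightarrow> inv h \<in> K #> inv h'"
      using c K_subgroup repr_independence[of "inv h" K "inv h'"] rcos_self[of "inv h" K] by auto
    also have "\<dots> \<longleftrightarrow> inv h \<otimes> h' \<in> K"
      using subgroup.rcos_module[OF K_subgroup group_axioms c(2) c(1)] that H_carrier by simp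
    finally show ?thesis
      using that H_carrier by (simp add: scc_of_eq_iff reachable_in_H_iff)
  qed
  then have "card (scc_of ` H) = card ((\<lambda>h. K #> inv h) ` H)"
    by (rule card_image_eq_if_same_fibres)
  also have "(\<lambda>h. K #> inv h) ` H = (#>) K ` (m_inv G ` H)"
    by (simp add: image_image)
  also have "m_inv G ` H = H"
    using H_inv H_carrier by (auto intro!: image_eqI[of _ _ "inv x" for x])
  also have "(#>) K ` H = rcosets\<^bsub>G\<lparr>carrier := H\<rparr>\<^esub> K"
    by (auto simp: RCOSETS_def)
  finally show ?thesis
    by (simp add: subgroup_index_def)
qed

section \<open>Vertices outside \<open>H\<close> and the final count\<close>

text \<open>Every arc has an end in \<open>H\<close>, so a neighbour of \<open>v\<close> would lie
  in \<open>H\<close> and place \<open>v\<close> in a coset that belongs to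
  \<open>U\<close>.\<close>

lemma scc_of_isolated:
  assumes "v \<in> carrier G - H - U"
  shows "scc_of v = {v}"
proof -
  have no_arc: "(v, y) \<notin> parcs \<Gamma>" for y
  proof
    assume "(v, y) \<in> parcs \<Gamma>"
    then obtain s where "s \<in> S" "y \<in> H" "v = y \<otimes> s"
      using assms by (auto simp: arc_iff)
    moreover from this have "s \<in> S\<^sub>O"
      using assms H_mult by (auto simp: S\<^sub>O_def)
    ultimately have "v \<in> U"
      by (auto simp: U_def r_coset_def)
    then show False
      using assms by blast
  qed
  \<comment> \<open>A nontrivial walk would begin with an arc at \<open>v\<close>.\<close>
  have "w = v" if "v \<rightarrow>\<^sup>*\<^bsub>with_proj \<Gamma>\<^esub> w" for w
    using that by (cases rule: converse_reachable_cases) (auto simp: no_arc)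
  then show ?thesis
    using assms in_scc_of_self[of v] by (auto simp: scc_of_def)
qed

lemma scc_of_U:
  assumes "v \<in> U"
  shows "scc_of v \<in> scc_of ` H"
proof -
  obtain h s where hs: "h \<in> H" "s \<in> S\<^sub>O" "v = h \<otimes> s"
    using assms by (auto simp: U_def r_coset_def)
  then have "h \<rightarrow>\<^bsub>with_proj \<Gamma>\<^esub> v"
    by (auto simp: arc_iff S\<^sub>O_def)
  then have "scc_of h = scc_of v"
    using hs H_carrier S\<^sub>O_carrier by (simp add: scc_of_eq_iff)
  then show ?thesis
    using hs(1) by (metis imageI)
qed

text \<open>The vertices split into \<open>H\<close>, \<open>U\<close> and the isolated rest;
  \<open>U\<close> contributes no component beyond those meeting \<open>H\<close>.\<close>

lemma sccs_verts_eq: "sccs_verts = scc_of ` H \<union> (\<lambda>v. {v}) ` (carrier G - H - U)"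
proof -
  have "carrier G = H \<union> U \<union> (carrier G - H - U)"
    using U_subset H_carrier by auto
  then have "sccs_verts = scc_of ` H \<union> scc_of ` U \<union> scc_of ` (carrier G - H - U)"
    unfolding sccs_verts_conv_scc_of with_proj_simps pverts_\<Gamma> by (metis image_Un)
  also have "scc_of ` (carrier G - H - U) = (\<lambda>v. {v}) ` (carrier G - H - U)"
    using scc_of_isolated by (intro image_cong) auto
  finally show ?thesis
    using scc_of_U by blast
qed

lemma card_connected_components:
  assumes "finite (carrier G)"
  shows "int (card (connected_components (with_proj \<Gamma>))) =
    int (subgroup_index G H K) + int (card (carrier G - H)) - int (card U)"
proof -
  have "finite H"
    using assms subgroup.subset[OF H_subgroup] by (rule finite_subset[rotated])
  have "finite U"
    using assms U_subset by (auto intro: finite_subset)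
  \<comment> \<open>A component on the left contains an element of \<open>H\<close>, a singleton on
    the right does not.\<close>
  have "scc_of ` H \<inter> (\<lambda>v. {v}) ` (carrier G - H - U) = {}"
    using in_scc_of_self H_carrier by fastforce
  then have "card sccs_verts = card (scc_of ` H) + card (carrier G - H - U)"
    unfolding sccs_verts_eq using assms \<open>finite H\<close>
    by (simp add: card_Un_disjoint card_image)
  moreover have "int (card (carrier G - H - U)) = int (card (carrier G - H)) - int (card U)"
    using U_subset \<open>finite U\<close> assms card_mono[OF _ U_subset] by (simp add: card_Diff_subset of_nat_diff)
  ultimately show ?thesis
    by (simp add: connected_components_eq_sccs card_sccs_verts[symmetric] card_scc_of_H)
qed

end

theorem theorem3p6:
  fixes G :: "('a, 'b) monoid_scheme" and H S :: "'a set"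
  assumes "group G" and "finite (carrier G)"
    and "subgroup H G"
    and "S \<subseteq> carrier G"
    and "set_inv\<^bsub>G\<^esub> (S \<inter> H) = S \<inter> H"
  shows "int (card (connected_components (with_proj (group_subgroup_pair_graph G H S)))) =
    int (subgroup_index G H
      (generate G (H \<inter> ((S \<inter> H) \<union> ((S - H) <#>\<^bsub>G\<^esub> (set_inv\<^bsub>G\<^esub> (S - H)))))))
    + int (card (carrier G - H)) - int (card (\<Union>s\<in>S - H. H #>\<^bsub>G\<^esub> s))"
proof -
  interpret group_subgroup_pair G H S
    using assms by (simp add: group_subgroup_pair_def group_subgroup_pair_axioms_def)
  show ?thesis
    using card_connected_components[OF assms(2)] by (simp add: K_def U_def S\<^sub>O_def)
qed

end
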